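(* Let $A$ be a $2\times 2$ real Hurwitz matrix whose two eigenvalues are complex, denoted by $\lambda_{1,2} = \alpha \pm \beta j$ with $\alpha, \beta$ real, $\alpha<0$ and $\beta\neq 0$. Then there exists a real non-singular matrix $P_1$ such that $P_1 A P_1^{-1} = B_1$, where $$B_1=\begin{bmatrix} \alpha & \beta \\ -\beta & \alpha\end{bmatrix}.$$ Furthermore: (i) if $|\alpha| > |\beta|$, then there exists a real non-singular matrix $P$ such that $PAP^{-1}$ is a strictly diagonal dominant real matrix; (ii) if $|\alpha| = |\beta|$, then there exists a real non-singular matrix $P$ such that $PAP^{-1}$ is a non-strict diagonal dominant real matrix; (iii) if $|\alpha| < |\beta|$, then there does not exist a real non-singular matrix $P$ such that $PAP^{-1}$ is a (non-strict) diagonal dominant real matrix.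
   Context: A real square matrix is Hurwitz if all its eigenvalues have negative real parts. A real matrix $B=\{b_{ij}\}\in\mathbb{R}^{n\times n}$ is (non-strict) row-diagonal dominant if $|b_{ii}| \ge \sum_{k\ne i} |b_{ik}|$ for all $i=1,\dots,n$, and strictly row-diagonal dominant if all these inequalities are strict. (Strict) column-diagonal dominance is defined in the same way using the off-diagonal column sums $\sum_{k\neq i}|b_{ki}|$. A matrix is (strictly) diagonal dominant if it is either (strictly) row-diagonal dominant or (strictly) column-diagonal dominant; "non-strict diagonal dominant" means the non-strict inequalities are satisfied. Here $j$ denotes the imaginary unit. *)

theory Defs
  imports "Jordan_Normal_Form.Spectral_Radius"
begin

definition complex_spectrum :: "real mat \<Rightarrow> complex set" where
  "complex_spectrum A = spectrum (map_mat complex_of_real A)"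

definition hurwitz_mat :: "real mat \<Rightarrow> bool" where
  "hurwitz_mat A \<longleftrightarrow> square_mat A \<and> (\<forall>l \<in> complex_spectrum A. Re l < 0)"

definition row_diag_dominant :: "real mat \<Rightarrow> bool" where
  "row_diag_dominant B \<longleftrightarrow> square_mat B \<and>
     (\<forall>i < dim_row B. \<bar>B $$ (i,i)\<bar> \<ge> (\<Sum>k \<in> {..<dim_row B} - {i}. \<bar>B $$ (i,k)\<bar>))"

definition strict_row_diag_dominant :: "real mat \<Rightarrow> bool" where
  "strict_row_diag_dominant B \<longleftrightarrow> square_mat B \<and>
     (\<forall>i < dim_row B. \<bar>B $$ (i,i)\<bar> > (\<Sum>k \<in> {..<dim_row B} - {i}. \<bar>B $$ (i,k)\<bar>))"

definition col_diag_dominant :: "real mat \<Rightarrow> bool" where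
  "col_diag_dominant B \<longleftrightarrow> square_mat B \<and>
     (\<forall>i < dim_row B. \<bar>B $$ (i,i)\<bar> \<ge> (\<Sum>k \<in> {..<dim_row B} - {i}. \<bar>B $$ (k,i)\<bar>))"

definition strict_col_diag_dominant :: "real mat \<Rightarrow> bool" where
  "strict_col_diag_dominant B \<longleftrightarrow> square_mat B \<and>
     (\<forall>i < dim_row B. \<bar>B $$ (i,i)\<bar> > (\<Sum>k \<in> {..<dim_row B} - {i}. \<bar>B $$ (k,i)\<bar>))"

definition diag_dominant :: "real mat \<Rightarrow> bool" where
  "diag_dominant B \<longleftrightarrow> row_diag_dominant B \<or> col_diag_dominant B"

definition strict_diag_dominant :: "real mat \<Rightarrow> bool" where
  "strict_diag_dominant B \<longleftrightarrow> strict_row_diag_dominant B \<or> strict_col_diag_dominant B"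

(* is_inv_pair n P Q: the n x n matrix P is non-singular and Q is its (unique) inverse. *)
definition is_inv_pair :: "nat \<Rightarrow> real mat \<Rightarrow> real mat \<Rightarrow> bool" where
  "is_inv_pair n P Q \<longleftrightarrow> P \<in> carrier_mat n n \<and> Q \<in> carrier_mat n n \<and>
     inverts_mat P Q \<and> inverts_mat Q P"

end

theory Submission
  imports Defs
begin

text \<open>
  The eigenvalues give \<open>tr A = 2\<alpha>\<close> and \<open>det A = \<alpha>\<^sup>2 + \<beta>\<^sup>2\<close>, and \<open>B\<^sub>1\<close> itself witnesses (i) and (ii).
  For (iii), let \<open>C\<close> be similar to \<open>A\<close>, \<open>p\<close> the product of its diagonal entries and \<open>q\<close> that of its
  off-diagonal ones. Then \<open>p - q = \<alpha>\<^sup>2 + \<beta>\<^sup>2\<close>, and \<open>p \<le> \<alpha>\<^sup>2\<close> because the diagonal entries sum to \<open>2\<alpha>\<close>.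
  Row as well as column dominance gives \<open>\<bar>q\<bar> \<le> \<bar>p\<bar>\<close>, hence \<open>\<alpha>\<^sup>2 + \<beta>\<^sup>2 \<le> 2p \<le> 2\<alpha>\<^sup>2\<close>.
\<close>

lemma mat_2_2_eqI:
  assumes "M \<in> carrier_mat 2 2" "N \<in> carrier_mat 2 2"
    and "M $$ (0,0) = N $$ (0,0)" "M $$ (0,1) = N $$ (0,1)"
    and "M $$ (1,0) = N $$ (1,0)" "M $$ (1,1) = N $$ (1,1)"
  shows "M = N"
  using assms by (intro eq_matI) (auto simp: less_2_cases_iff)

lemma index_mult_mat_2_2:
  assumes "M \<in> carrier_mat 2 2" "N \<in> carrier_mat 2 2" "i < 2" "j < 2"
  shows "(M * N) $$ (i,j) = M $$ (i,0) * N $$ (0,j) + M $$ (i,1) * N $$ (1,j)"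
  using assms by (simp add: scalar_prod_def numeral_2_eq_2)

lemma det_2_2:
  fixes M :: "'a :: comm_ring_1 mat"
  assumes M: "M \<in> carrier_mat 2 2"
  shows "det M = M $$ (0,0) * M $$ (1,1) - M $$ (0,1) * M $$ (1,0)"
proof -
  have "det M = (\<Sum>j<2. M $$ (0,j) * cofactor M 0 j)"
    using laplace_expansion_row[OF M, of 0] by simp
  also have "\<dots> = M $$ (0,0) * cofactor M 0 0 + M $$ (0,1) * cofactor M 0 1"
    by (simp add: numeral_2_eq_2)
  also have "cofactor M 0 0 = M $$ (1,1)"
    using M det_single[of "mat_delete M 0 0"] by (simp add: cofactor_def mat_delete_def)
  also have "cofactor M 0 1 = - M $$ (1,0)"
    using M det_single[of "mat_delete M 0 1"] by (simp add: cofactor_def mat_delete_def)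
  finally show ?thesis by simp
qed

lemma char_poly_2_2:
  fixes M :: "'a :: comm_ring_1 mat"
  assumes "M \<in> carrier_mat 2 2"
  shows "char_poly M =
    [: M $$ (0,0) * M $$ (1,1) - M $$ (0,1) * M $$ (1,0), - (M $$ (0,0) + M $$ (1,1)), 1 :]"
  using assms by (simp add: char_poly_def char_poly_matrix_def det_2_2)

text \<open>The characteristic equation at the eigenvalue splits into two real equations. The
  imaginary part, divided by \<beta>, gives the trace; substituting it into the real part gives the
  determinant.\<close>

lemma char_poly_2_2_of_complex_eigenvalue:
  fixes A :: "real mat" and \<alpha> \<beta> :: real
  assumes A: "A \<in> carrier_mat 2 2"
    and ev: "Complex \<alpha> \<beta> \<in> complex_spectrum A" and "\<beta> \<noteq> 0"
  shows "char_poly A = [: \<alpha>\<^sup>2 + \<beta>\<^sup>2, - 2 * \<alpha>, 1 :]"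
proof -
  let ?t = "A $$ (0,0) + A $$ (1,1)"
  let ?d = "A $$ (0,0) * A $$ (1,1) - A $$ (0,1) * A $$ (1,0)"
  have "map_mat complex_of_real A \<in> carrier_mat 2 2" using A by simp
  with ev have "poly (char_poly (map_mat complex_of_real A)) (Complex \<alpha> \<beta>) = 0"
    by (simp add: complex_spectrum_def spectrum_def eigenvalue_root_char_poly)
  then have root: "\<alpha> * \<alpha> - \<beta> * \<beta> - \<alpha> * ?t + ?d = 0" "2 * \<alpha> * \<beta> = \<beta> * ?t"
    using A by (simp_all add: char_poly_2_2 complex_eq_iff algebra_simps)
  then have t: "?t = 2 * \<alpha>" using \<open>\<beta> \<noteq> 0\<close> by simp
  with root have "?d = \<alpha>\<^sup>2 + \<beta>\<^sup>2" by (simp add: power2_eq_square)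
  with t show ?thesis using A by (simp add: char_poly_2_2)
qed

lemma char_poly_conjugate:
  assumes "is_inv_pair n P Q" "A \<in> carrier_mat n n"
  shows "char_poly (P * A * Q) = char_poly A"
proof (rule char_poly_similar)
  show "similar_mat (P * A * Q) A"
    using assms unfolding is_inv_pair_def inverts_mat_def
    by (intro similar_matI[of _ _ P Q n]) auto
qed

lemma real_canonical_form_2_2:
  fixes A :: "real mat" and \<alpha> \<beta> :: real
  assumes A: "A \<in> carrier_mat 2 2"
    and cp: "char_poly A = [: \<alpha>\<^sup>2 + \<beta>\<^sup>2, - 2 * \<alpha>, 1 :]" and \<beta>: "\<beta> \<noteq> 0"
  shows "\<exists>P Q. is_inv_pair 2 P Q \<and> P * A * Q = mat_of_rows_list 2 [[\<alpha>, \<beta>], [- \<beta>, \<alpha>]]"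
proof -
  define a b c d where abcd: "a = A $$ (0,0)" "b = A $$ (0,1)" "c = A $$ (1,0)" "d = A $$ (1,1)"
  have d: "d = 2 * \<alpha> - a" and "a * d - b * c = \<alpha>\<^sup>2 + \<beta>\<^sup>2"
    using cp A by (simp_all add: char_poly_2_2 abcd)
  then have bc: "b * c = - (a - \<alpha>)\<^sup>2 - \<beta>\<^sup>2"
    unfolding d by (simp add: power2_eq_square algebra_simps)
  \<comment> \<open>A real matrix with non-real eigenvalues cannot be triangular. That
    \<open>b\<close> is nonzero makes the \<open>P\<close> chosen below invertible, its determinant
    being \<open>b / \<beta>\<close>.\<close>
  have "b * c < 0"
    unfolding bc using zero_le_power2[of "a - \<alpha>"] \<beta> by (smt (verit) zero_less_power2)
  then have b: "b \<noteq> 0" by auto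
  \<comment> \<open>The first row of \<open>P A = B\<^sub>1 P\<close> determines the second row of \<open>P\<close> from the first,
    which is chosen to be \<open>(1, 0)\<close>.\<close>
  define P where "P = mat_of_rows_list 2 [[1, 0], [(a - \<alpha>) / \<beta>, b / \<beta>]]"
  define Q where "Q = mat_of_rows_list 2 [[1, 0], [- (a - \<alpha>) / b, \<beta> / b]]"
  have PQ: "P \<in> carrier_mat 2 2" "Q \<in> carrier_mat 2 2"
    by (auto simp: P_def Q_def mat_of_rows_list_def)
  have P: "P $$ (0,0) = 1" "P $$ (0,1) = 0" "P $$ (1,0) = (a - \<alpha>) / \<beta>" "P $$ (1,1) = b / \<beta>"
    and Q: "Q $$ (0,0) = 1" "Q $$ (0,1) = 0" "Q $$ (1,0) = - (a - \<alpha>) / b" "Q $$ (1,1) = \<beta> / b"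
    by (simp_all add: P_def Q_def mat_of_rows_list_def)
  have "P * Q = 1\<^sub>m 2" "Q * P = 1\<^sub>m 2"
    using PQ b \<beta> by (auto intro!: mat_2_2_eqI simp: index_mult_mat_2_2 P Q
        simp del: index_mult_mat One_nat_def)
      (simp_all add: diff_divide_distrib)
  with PQ have "is_inv_pair 2 P Q" by (simp add: is_inv_pair_def inverts_mat_def)
  moreover have "P * A * Q = mat_of_rows_list 2 [[\<alpha>, \<beta>], [- \<beta>, \<alpha>]]"
  proof (rule mat_2_2_eqI)
    \<comment> \<open>The first row of \<open>P * A = B\<^sub>1 * P\<close> holds by the choice of
      \<open>P\<close>. The second row amounts to Cayley-Hamilton, (A - \<alpha> I)^2 = -\<beta>^2
      I, which enters by eliminating \<open>c\<close> and \<open>d\<close>.\<close>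
    have c: "c = (- (a - \<alpha>)\<^sup>2 - \<beta>\<^sup>2) / b" using bc b by (simp add: field_simps)
    note idx = index_mult_mat_2_2 P Q abcd[symmetric] mat_of_rows_list_def PQ A
      mult_carrier_mat[OF PQ(1) A]
    show "(P * A * Q) $$ (0,0) = mat_of_rows_list 2 [[\<alpha>, \<beta>], [- \<beta>, \<alpha>]] $$ (0,0)"
      "(P * A * Q) $$ (0,1) = mat_of_rows_list 2 [[\<alpha>, \<beta>], [- \<beta>, \<alpha>]] $$ (0,1)"
      "(P * A * Q) $$ (1,0) = mat_of_rows_list 2 [[\<alpha>, \<beta>], [- \<beta>, \<alpha>]] $$ (1,0)"
      "(P * A * Q) $$ (1,1) = mat_of_rows_list 2 [[\<alpha>, \<beta>], [- \<beta>, \<alpha>]] $$ (1,1)"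
      using b \<beta> by (simp_all add: idx del: index_mult_mat One_nat_def)
        (simp_all add: c d field_simps power2_eq_square)
  qed (use A PQ in \<open>auto simp: mat_of_rows_list_def\<close>)
  ultimately show ?thesis by blast
qed

lemma lessThan_2_minus: "{..<2::nat} - {0} = {1}" "{..<2::nat} - {1} = {0}"
  by auto

lemma diag_dominant_2_2_abs_le:
  assumes "C \<in> carrier_mat 2 2" "diag_dominant C"
  shows "\<bar>C $$ (0,1) * C $$ (1,0)\<bar> \<le> \<bar>C $$ (0,0) * C $$ (1,1)\<bar>"
proof -
  let ?e = "\<bar>C $$ (0,0)\<bar>" and ?f = "\<bar>C $$ (0,1)\<bar>"
    and ?g = "\<bar>C $$ (1,0)\<bar>" and ?h = "\<bar>C $$ (1,1)\<bar>"
  \<comment> \<open>The first disjunct is row dominance, the second column dominance. They only pair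
    the off-diagonal entries with the diagonal ones differently, so multiplying the two inequalities
    gives the same bound.\<close>
  have "?f \<le> ?e \<and> ?g \<le> ?h \<or> ?g \<le> ?e \<and> ?f \<le> ?h"
    using assms by (simp add: diag_dominant_def row_diag_dominant_def col_diag_dominant_def
        less_2_cases_iff all_conj_distrib imp_disjL lessThan_2_minus lessThan_2_minus[simplified])
  then have "?f * ?g \<le> ?e * ?h"
    using mult_mono[of ?f ?e ?g ?h] mult_mono[of ?g ?e ?f ?h] by (auto simp: mult.commute)
  then show ?thesis by (simp add: abs_mult)
qed

text \<open>The matrix enters through its characteristic polynomial, a similarity invariant, so this
  rules out all conjugates of \<open>A\<close> at once.\<close>

lemma not_diag_dominant_2_2:
  fixes C :: "real mat" and \<alpha> \<beta> :: real
  assumes C: "C \<in> carrier_mat 2 2"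
    and cp: "char_poly C = [: \<alpha>\<^sup>2 + \<beta>\<^sup>2, - 2 * \<alpha>, 1 :]" and less: "\<bar>\<alpha>\<bar> < \<bar>\<beta>\<bar>"
  shows "\<not> diag_dominant C"
proof
  assume "diag_dominant C"
  define p q where pq: "p = C $$ (0,0) * C $$ (1,1)" "q = C $$ (0,1) * C $$ (1,0)"
  have tr: "C $$ (0,0) + C $$ (1,1) = 2 * \<alpha>" and det: "p - q = \<alpha>\<^sup>2 + \<beta>\<^sup>2"
    using cp C by (simp_all add: char_poly_2_2 pq)
  have h: "C $$ (1,1) = 2 * \<alpha> - C $$ (0,0)" using tr by simp
  \<comment> \<open>AM-GM with its exact gap: the diagonal entries have mean \<alpha>, so their
    product falls short of \<alpha>^2 by the squared deviation from the mean.\<close>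
  have "\<alpha>\<^sup>2 - p = (C $$ (0,0) - \<alpha>)\<^sup>2"
    unfolding pq h by (simp add: power2_eq_square algebra_simps)
  then have p: "p \<le> \<alpha>\<^sup>2" using zero_le_power2[of "C $$ (0,0) - \<alpha>"] by linarith
  have "\<alpha>\<^sup>2 < \<beta>\<^sup>2" using less by (simp add: abs_le_square_iff flip: not_le)
  moreover have "\<bar>q\<bar> \<le> \<bar>p\<bar>"
    using diag_dominant_2_2_abs_le[OF C \<open>diag_dominant C\<close>] by (simp add: pq)
  \<comment> \<open>If p were at most 0, then \<bar>q\<bar> \<le> -p would give p - q \<le> 0,
    against \<alpha>^2 + \<beta>^2 > 0. So p is positive and p - q \<le> 2p \<le> 2\<alpha>^2 <
    \<alpha>^2 + \<beta>^2.\<close>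
  ultimately show False using p det zero_le_power2[of \<alpha>] by linarith
qed

lemma
  fixes \<alpha> \<beta> :: real
  shows diag_dominant_rotation_scaling:
      "\<bar>\<beta>\<bar> \<le> \<bar>\<alpha>\<bar> \<Longrightarrow> diag_dominant (mat_of_rows_list 2 [[\<alpha>, \<beta>], [- \<beta>, \<alpha>]])"
    and strict_diag_dominant_rotation_scaling:
      "\<bar>\<beta>\<bar> < \<bar>\<alpha>\<bar> \<Longrightarrow> strict_diag_dominant (mat_of_rows_list 2 [[\<alpha>, \<beta>], [- \<beta>, \<alpha>]])"
proof -
  let ?B = "mat_of_rows_list 2 [[\<alpha>, \<beta>], [- \<beta>, \<alpha>]]"
  have B: "?B \<in> carrier_mat 2 2" "?B $$ (0,0) = \<alpha>" "?B $$ (0,1) = \<beta>" "?B $$ (1,0) = - \<beta>"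
      "?B $$ (1,1) = \<alpha>"
    by (auto simp: mat_of_rows_list_def)
  show "diag_dominant ?B" if "\<bar>\<beta>\<bar> \<le> \<bar>\<alpha>\<bar>"
    using B that by (simp add: diag_dominant_def row_diag_dominant_def less_2_cases_iff
        all_conj_distrib imp_disjL lessThan_2_minus lessThan_2_minus[simplified])
  show "strict_diag_dominant ?B" if "\<bar>\<beta>\<bar> < \<bar>\<alpha>\<bar>"
    using B that by (simp add: strict_diag_dominant_def strict_row_diag_dominant_def
        less_2_cases_iff all_conj_distrib imp_disjL lessThan_2_minus lessThan_2_minus[simplified])
qed

theorem theorem1:
  fixes A :: "real mat" and \<alpha> \<beta> :: real
  assumes "A \<in> carrier_mat 2 2"
    and "hurwitz_mat A"
    and "complex_spectrum A =
           {complex_of_real \<alpha> + complex_of_real \<beta> * \<i>, complex_of_real \<alpha> - complex_of_real \<beta> * \<i>}"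
    and "\<alpha> < 0"
    and "\<beta> \<noteq> 0"
  shows "(\<exists>P1 Q1. is_inv_pair 2 P1 Q1 \<and>
            P1 * A * Q1 = mat_of_rows_list 2 [[\<alpha>, \<beta>], [- \<beta>, \<alpha>]]) \<and>
         (\<bar>\<alpha>\<bar> > \<bar>\<beta>\<bar> \<longrightarrow> (\<exists>P Q. is_inv_pair 2 P Q \<and> strict_diag_dominant (P * A * Q))) \<and>
         (\<bar>\<alpha>\<bar> = \<bar>\<beta>\<bar> \<longrightarrow> (\<exists>P Q. is_inv_pair 2 P Q \<and> diag_dominant (P * A * Q))) \<and>
         (\<bar>\<alpha>\<bar> < \<bar>\<beta>\<bar> \<longrightarrow> \<not> (\<exists>P Q. is_inv_pair 2 P Q \<and> diag_dominant (P * A * Q)))"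
proof -
  have "Complex \<alpha> \<beta> \<in> complex_spectrum A"
    using assms(3) by (simp add: complex_eq_iff)
  then have cp: "char_poly A = [: \<alpha>\<^sup>2 + \<beta>\<^sup>2, - 2 * \<alpha>, 1 :]"
    using char_poly_2_2_of_complex_eigenvalue assms(1,5) by blast
  obtain P Q where PQ: "is_inv_pair 2 P Q"
    and B: "P * A * Q = mat_of_rows_list 2 [[\<alpha>, \<beta>], [- \<beta>, \<alpha>]]"
    using real_canonical_form_2_2[OF assms(1) cp assms(5)] by blast
  have "strict_diag_dominant (P * A * Q)" if "\<bar>\<alpha>\<bar> > \<bar>\<beta>\<bar>"
    using that unfolding B by (rule strict_diag_dominant_rotation_scaling)
  moreover have "diag_dominant (P * A * Q)" if "\<bar>\<alpha>\<bar> = \<bar>\<beta>\<bar>"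
    unfolding B using that by (intro diag_dominant_rotation_scaling) simp
  \<comment> \<open>\<open>R\<close> and \<open>S\<close> are arbitrary here, unlike the fixed
    \<open>P\<close> and \<open>Q\<close> that serve the two positive cases.\<close>
  moreover have "\<not> diag_dominant (R * A * S)" if "\<bar>\<alpha>\<bar> < \<bar>\<beta>\<bar>" "is_inv_pair 2 R S" for R S
  proof (rule not_diag_dominant_2_2[OF _ _ that(1)])
    show "R * A * S \<in> carrier_mat 2 2"
      using that(2) assms(1) by (auto simp: is_inv_pair_def)
    show "char_poly (R * A * S) = [: \<alpha>\<^sup>2 + \<beta>\<^sup>2, - 2 * \<alpha>, 1 :]"
      using char_poly_conjugate[OF that(2) assms(1)] cp by simp
  qed
  ultimately show ?thesis using PQ B by blast
qed

end
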